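(* Let $n\ge 3$ be odd and let $\beta_3,\dots,\beta_n,\gamma\in\mathbb{C}$ with $\gamma\neq 0$. If the filiform Leibniz algebra $F_2(\beta_3,\beta_4,\dots,\beta_n,\gamma)$ is non-characteristically nilpotent, then it is isomorphic to the algebra $F_2(0,0,\dots,0,0,1)$ (all $\beta_k=0$ and $\gamma=1$).
   Context: A Leibniz algebra is a vector space with a bilinear bracket satisfying $[[x,y],z]=[[x,z],y]+[x,[y,z]]$. A derivation of a Leibniz algebra $L$ is a linear map $d:L\to L$ with $d([x,y])=[d(x),y]+[x,d(y)]$. With $L^1=L$, $L^{k+1}=[L^k,L]$, $L$ is nilpotent if $L^s=0$ for some $s$. A nilpotent Leibniz algebra is characteristically nilpotent if all its derivations are nilpotent linear maps, and non-characteristically nilpotent if it is nilpotent but admits a non-nilpotent derivation. For complex parameters, $F_2(\beta_3,\dots,\beta_n,\gamma)$ denotes the $(n+1)$-dimensional complex Leibniz algebra with basis $\{e_0,e_1,\dots,e_n\}$ and products $[e_0,e_0]=e_2$; $[e_i,e_0]=e_{i+1}$ for $2\le i\le n-1$; $[e_0,e_1]=\sum_{k=3}^n\beta_ke_k$; $[e_1,e_1]=\gamma e_n$; $[e_i,e_1]=\sum_{k=i+2}^n\beta_{k+1-i}e_k$ for $2\le i\le n-2$; all other products of basis elements are zero. *)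

theory Defs
  imports Complex_Main "HOL-Library.Function_Algebras"
begin

section \<open>Leibniz algebras\<close>

text \<open>The underlying vector space is a subspace \<open>space A\<close> of an ambient type. Every condition below
  only concerns elements of \<open>space A\<close>; in particular, linear maps between algebras are functions on
  the ambient types whose values outside \<open>space A\<close> are irrelevant.\<close>

record ('k, 'a) bracket_algebra =
  space :: "'a set"
  smul :: "'k \<Rightarrow> 'a \<Rightarrow> 'a"
  bracket :: "'a \<Rightarrow> 'a \<Rightarrow> 'a"

locale leibniz_algebra = vector_space "smul A"
  for A :: "('k::field, 'a::ab_group_add) bracket_algebra" +
  assumes subspace_space: "subspace (space A)"
    and bracket_closed: "\<lbrakk>x \<in> space A; y \<in> space A\<rbrakk> \<Longrightarrow> bracket A x y \<in> space A"
    and bracket_add_left: "\<lbrakk>x \<in> space A; y \<in> space A; z \<in> space A\<rbrakk>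
      \<Longrightarrow> bracket A (x + y) z = bracket A x z + bracket A y z"
    and bracket_add_right: "\<lbrakk>x \<in> space A; y \<in> space A; z \<in> space A\<rbrakk>
      \<Longrightarrow> bracket A x (y + z) = bracket A x y + bracket A x z"
    and bracket_smul_left: "\<lbrakk>x \<in> space A; y \<in> space A\<rbrakk>
      \<Longrightarrow> bracket A (smul A c x) y = smul A c (bracket A x y)"
    and bracket_smul_right: "\<lbrakk>x \<in> space A; y \<in> space A\<rbrakk>
      \<Longrightarrow> bracket A x (smul A c y) = smul A c (bracket A x y)"
    and leibniz_identity: "\<lbrakk>x \<in> space A; y \<in> space A; z \<in> space A\<rbrakk>
      \<Longrightarrow> bracket A (bracket A x y) z = bracket A (bracket A x z) y + bracket A x (bracket A y z)"

definition linear_map ::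
  "('k::field, 'a::ab_group_add) bracket_algebra \<Rightarrow> ('k, 'b::ab_group_add) bracket_algebra
    \<Rightarrow> ('a \<Rightarrow> 'b) \<Rightarrow> bool" where
  "linear_map A B f \<longleftrightarrow>
     (\<forall>x\<in>space A. f x \<in> space B) \<and>
     (\<forall>x\<in>space A. \<forall>y\<in>space A. f (x + y) = f x + f y) \<and>
     (\<forall>c. \<forall>x\<in>space A. f (smul A c x) = smul B c (f x))"

definition derivation ::
  "('k::field, 'a::ab_group_add) bracket_algebra \<Rightarrow> ('a \<Rightarrow> 'a) \<Rightarrow> bool" where
  "derivation A d \<longleftrightarrow> linear_map A A d \<and>
     (\<forall>x\<in>space A. \<forall>y\<in>space A. d (bracket A x y) = bracket A (d x) y + bracket A x (d y))"

definition nilpotent_map ::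
  "('k::field, 'a::ab_group_add) bracket_algebra \<Rightarrow> ('a \<Rightarrow> 'a) \<Rightarrow> bool" where
  "nilpotent_map A d \<longleftrightarrow> (\<exists>m. \<forall>x\<in>space A. (d ^^ m) x = 0)"

text \<open>The index is shifted by one: \<open>lower_central A k\<close> is $L^{k+1}$.\<close>

primrec lower_central ::
  "('k::field, 'a::ab_group_add) bracket_algebra \<Rightarrow> nat \<Rightarrow> 'a set" where
  "lower_central A 0 = space A"
| "lower_central A (Suc k) =
     module.span (smul A) {bracket A x y | x y. x \<in> lower_central A k \<and> y \<in> space A}"

definition nilpotent_algebra :: "('k::field, 'a::ab_group_add) bracket_algebra \<Rightarrow> bool" where
  "nilpotent_algebra A \<longleftrightarrow> (\<exists>s. lower_central A s = {0})"

definition non_characteristically_nilpotent ::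
  "('k::field, 'a::ab_group_add) bracket_algebra \<Rightarrow> bool" where
  "non_characteristically_nilpotent A \<longleftrightarrow>
     nilpotent_algebra A \<and> (\<exists>d. derivation A d \<and> \<not> nilpotent_map A d)"

definition isomorphic ::
  "('k::field, 'a::ab_group_add) bracket_algebra \<Rightarrow> ('k, 'b::ab_group_add) bracket_algebra
    \<Rightarrow> bool" where
  "isomorphic A B \<longleftrightarrow>
     (\<exists>f. linear_map A B f \<and> bij_betw f (space A) (space B) \<and>
        (\<forall>x\<in>space A. \<forall>y\<in>space A. f (bracket A x y) = bracket B (f x) (f y)))"


section \<open>The algebras $F_2(\beta_3, \dots, \beta_n, \gamma)$\<close>

text \<open>The space $\mathbb{C}^{n+1}$ is realised as the functions \<open>nat \<Rightarrow> complex\<close> that vanish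
  beyond \<open>n\<close>, so that \<open>n\<close> can be a variable.\<close>

definition fscale :: "complex \<Rightarrow> (nat \<Rightarrow> complex) \<Rightarrow> nat \<Rightarrow> complex" where
  "fscale c x = (\<lambda>i. c * x i)"

definition e :: "nat \<Rightarrow> nat \<Rightarrow> complex" where
  "e k = (\<lambda>i. if i = k then 1 else 0)"

text \<open>The product of the basis elements \<open>e i\<close> and \<open>e j\<close>. Only the values \<open>\<beta> 3, \<dots>, \<beta> n\<close>
  of the sequence \<open>\<beta>\<close> are used.\<close>

definition F2_prod ::
  "nat \<Rightarrow> (nat \<Rightarrow> complex) \<Rightarrow> complex \<Rightarrow> nat \<Rightarrow> nat \<Rightarrow> nat \<Rightarrow> complex" where
  "F2_prod n \<beta> \<gamma> i j =
     (if i = 0 \<and> j = 0 then e 2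
      else if 2 \<le> i \<and> i \<le> n - 1 \<and> j = 0 then e (i + 1)
      else if i = 0 \<and> j = 1 then \<Sum>k=3..n. fscale (\<beta> k) (e k)
      else if i = 1 \<and> j = 1 then fscale \<gamma> (e n)
      else if 2 \<le> i \<and> i \<le> n - 2 \<and> j = 1 then \<Sum>k=i+2..n. fscale (\<beta> (k + 1 - i)) (e k)
      else 0)"

definition F2 ::
  "nat \<Rightarrow> (nat \<Rightarrow> complex) \<Rightarrow> complex \<Rightarrow> (complex, nat \<Rightarrow> complex) bracket_algebra" where
  "F2 n \<beta> \<gamma> =
     \<lparr>space = {x. \<forall>i>n. x i = 0},
      smul = fscale,
      bracket = (\<lambda>x y. \<Sum>i\<le>n. \<Sum>j\<le>n. fscale (x i * y j) (F2_prod n \<beta> \<gamma> i j))\<rparr>"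

lemma F2_simps [simp]:
  "space (F2 n \<beta> \<gamma>) = {x. \<forall>i>n. x i = 0}"
  "smul (F2 n \<beta> \<gamma>) = fscale"
  "bracket (F2 n \<beta> \<gamma>) x y = (\<Sum>i\<le>n. \<Sum>j\<le>n. fscale (x i * y j) (F2_prod n \<beta> \<gamma> i j))"
  by (simp_all add: F2_def)

interpretation fs: vector_space fscale
  by unfold_locales (simp_all add: fscale_def fun_eq_iff algebra_simps)

lemma fscale_apply: "fscale c x i = c * x i"
  by (simp add: fscale_def)

lemma sum_fun_apply: "(\<Sum>i\<in>I. f i) k = (\<Sum>i\<in>I. f i k)"
  for f :: "'i \<Rightarrow> nat \<Rightarrow> complex"
  by (induction I rule: infinite_finite_induct) simp_all

lemma F2_expand: "x \<in> space (F2 n \<beta> \<gamma>) \<Longrightarrow> x = (\<Sum>i\<le>n. fscale (x i) (e i))"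
  by (auto simp: fun_eq_iff sum_fun_apply fscale_def e_def if_distrib [of "\<lambda>t. _ * t"]
      not_le cong: if_cong)

text \<open>The elements \<open>e 0, \<dots>, e n\<close> form a basis with the required products, and the Leibniz
  identity holds.\<close>

lemma F2_span: "fs.span (e ` {..n}) = space (F2 n \<beta> \<gamma>)"
proof
  have "fs.subspace (space (F2 n \<beta> \<gamma>))"
    by (auto simp: fs.subspace_def fscale_def)
  moreover have "e ` {..n} \<subseteq> space (F2 n \<beta> \<gamma>)"
    by (auto simp: e_def)
  ultimately show "fs.span (e ` {..n}) \<subseteq> space (F2 n \<beta> \<gamma>)"
    by (rule fs.span_minimal [rotated])
  show "space (F2 n \<beta> \<gamma>) \<subseteq> fs.span (e ` {..n})"
  proof
    fix x assume "x \<in> space (F2 n \<beta> \<gamma>)"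
    then have "x = (\<Sum>i\<le>n. fscale (x i) (e i))" by (rule F2_expand)
    also have "\<dots> \<in> fs.span (e ` {..n})"
      by (intro fs.span_sum fs.span_scale fs.span_base) auto
    finally show "x \<in> fs.span (e ` {..n})" .
  qed
qed

lemma inj_e: "inj e"
  by (rule injI) (metis e_def zero_neq_one)

lemma F2_independent: "fs.independent (e ` {..n})"
proof (rule fs.independent_if_scalars_zero)
  fix f x
  assume 0: "(\<Sum>x\<in>e ` {..n}. fscale (f x) x) = 0" and "x \<in> e ` {..n}"
  then obtain k where k: "k \<le> n" "x = e k" by auto
  have "(\<Sum>i\<le>n. fscale (f (e i)) (e i)) = 0"
    using 0 by (subst (asm) sum.reindex) (auto intro: inj_on_subset [OF inj_e])
  then have "(\<Sum>i\<le>n. fscale (f (e i)) (e i)) k = 0" by simp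
  then show "f x = 0"
    using k by (simp add: sum_fun_apply fscale_def e_def if_distrib [of "\<lambda>t. _ * t"]
        cong: if_cong)
qed simp

lemma F2_bracket_basis:
  assumes "i \<le> n" "j \<le> n"
  shows "bracket (F2 n \<beta> \<gamma>) (e i) (e j) = F2_prod n \<beta> \<gamma> i j"
proof -
  have "(\<Sum>b\<le>n. fscale (e i a * e j b) (F2_prod n \<beta> \<gamma> a b)) =
      (if a = i then F2_prod n \<beta> \<gamma> i j else 0)" for a
  proof -
    have "(\<Sum>b\<le>n. fscale (e i a * e j b) (F2_prod n \<beta> \<gamma> a b)) =
       (\<Sum>b\<le>n. if b = j then (if a = i then F2_prod n \<beta> \<gamma> i j else 0) else 0)"
      by (rule sum.cong) (auto simp: e_def)
    then show ?thesis using assms by simp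
  qed
  then show ?thesis using assms by simp
qed

lemma F2_leibniz_algebra:
  assumes "n \<ge> 3"
  shows "leibniz_algebra (F2 n \<beta> \<gamma>)"
proof -
  let ?A = "F2 n \<beta> \<gamma>"
  let ?p = "F2_prod n \<beta> \<gamma>"
  let ?br = "bracket ?A"
  note [simp del] = F2_simps(1,3) plus_fun_apply zero_fun_apply
  have addl: "?br (x + y) z = ?br x z + ?br y z" for x y z
    by (simp add: F2_simps plus_fun_apply sum.distrib [symmetric] fs.scale_left_distrib distrib_right)
  have addr: "?br x (y + z) = ?br x y + ?br x z" for x y z
    by (simp add: F2_simps plus_fun_apply sum.distrib [symmetric] fs.scale_left_distrib distrib_left)
  have scl: "?br (fscale c x) y = fscale c (?br x y)" for c x y
    by (simp add: F2_simps fs.scale_sum_right fscale_apply mult.assoc)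
  have scr: "?br x (fscale c y) = fscale c (?br x y)" for c x y
    by (simp add: F2_simps fs.scale_sum_right fscale_apply mult_ac)
  have zl: "?br 0 y = 0" and zr: "?br y 0 = 0" for y
    by (simp_all add: F2_simps zero_fun_apply)
  have suml: "?br (\<Sum>i\<in>I. f i) y = (\<Sum>i\<in>I. ?br (f i) y)" for I :: "nat set" and f y
    by (induction I rule: infinite_finite_induct) (simp_all add: zl addl)
  have sub: "fs.subspace (space ?A)"
    by (auto simp: fs.subspace_def fscale_def F2_simps plus_fun_apply zero_fun_apply)
  have eS: "e i \<in> space ?A" if "i \<le> n" for i
    using that by (auto simp: e_def F2_simps)
  have pS: "?p i j \<in> space ?A" if "i \<le> n" for i j
    using assms that unfolding F2_prod_def
    by (auto intro!: fs.subspace_sum [OF sub] fs.subspace_scale [OF sub] eS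
        fs.subspace_0 [OF sub])
  have closed: "?br x y \<in> space ?A" for x y
    unfolding F2_simps(3)
    by (auto intro!: fs.subspace_sum [OF sub] fs.subspace_scale [OF sub] pS)
  have basis: "?br (e i) (e j) = ?p i j" if "i \<le> n" "j \<le> n" for i j
    using F2_bracket_basis that .
  \<comment> \<open>right multiplication by a product vanishes\<close>
  have high: "?br x (e k) = 0" if "2 \<le> k" "k \<le> n" for x k
  proof -
    have "fscale (x i * e k j) (?p i j) = 0" for i j
      using that by (auto simp: e_def F2_prod_def)
    then show ?thesis unfolding F2_simps(3) by (intro sum.neutral ballI)
  qed
  have sumr: "?br x (\<Sum>i\<in>I. f i) = (\<Sum>i\<in>I. ?br x (f i))" for I :: "nat set" and f x
    by (induction I rule: infinite_finite_induct) (simp_all add: zr addr)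
  have ann_p: "?br x (?p i j) = 0" if "i \<le> n" for x i j
    using assms that by (auto simp: F2_prod_def sumr scr high zr intro!: sum.neutral)
  have ann: "?br x (?br y z) = 0" for x y z
    by (subst F2_simps(3) [of _ _ _ y z]) (auto simp: sumr scr ann_p intro!: sum.neutral)
  \<comment> \<open>right multiplications by \<open>e 0\<close> and \<open>e 1\<close> commute\<close>
  have comm01: "?br (?br (e i) (e 0)) (e 1) = ?br (?br (e i) (e 1)) (e 0)" if i: "i \<le> n" for i
  proof -
    have b0: "?br (e k) (e 0) = (if k + 1 \<le> n then e (k + 1) else 0)" if "2 \<le> k" "k \<le> n" for k
      using that by (auto simp: basis F2_prod_def)
    have shift: "?br (\<Sum>k=m+2..n. fscale (\<beta> (k + 1 - m)) (e k)) (e 0) =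
        (\<Sum>k=m+3..n. fscale (\<beta> (k - m)) (e k))" for m
    proof -
      have "?br (\<Sum>k=m+2..n. fscale (\<beta> (k + 1 - m)) (e k)) (e 0) =
          (\<Sum>k=m+2..n. fscale (\<beta> (k + 1 - m)) (if k + 1 \<le> n then e (k + 1) else 0))"
        unfolding suml scl by (rule sum.cong) (auto simp: b0)
      also have "\<dots> = (\<Sum>k\<in>{m+2..n} \<inter> {k. k + 1 \<le> n}. fscale (\<beta> (k + 1 - m)) (e (k + 1)))"
        by (subst sum.inter_restrict) (auto intro!: sum.cong)
      also have "\<dots> = (\<Sum>k=m+3..n. fscale (\<beta> (k - m)) (e k))"
        by (rule sum.reindex_bij_witness [of _ "\<lambda>k. k - 1" "\<lambda>k. k + 1"]) auto
      finally show ?thesis .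
    qed
    have b1: "?br (e k) (e 1) = (\<Sum>l=k+2..n. fscale (\<beta> (l + 1 - k)) (e l))"
      if "2 \<le> k" "k \<le> n" for k
      using that assms by (auto simp: basis F2_prod_def)
    consider "i = 0" | "i = 1" | "i \<ge> 2" by linarith
    then show ?thesis
    proof cases
      case 1
      have "?br (?br (e 0) (e 0)) (e 1) = ?br (e 2) (e 1)"
        using assms by (simp add: basis F2_prod_def)
      also have "\<dots> = (\<Sum>l=1+3..n. fscale (\<beta> (l - 1)) (e l))"
        using assms by (subst b1) (auto intro!: sum.cong)
      also have "\<dots> = ?br (\<Sum>k=1+2..n. fscale (\<beta> (k + 1 - 1)) (e k)) (e 0)"
        by (rule shift [symmetric])
      also have "\<dots> = ?br (?br (e 0) (e 1)) (e 0)"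
        using assms by (simp add: basis F2_prod_def numeral_3_eq_3)
      finally show ?thesis using 1 by simp
    next
      case 2
      then show ?thesis
        using assms by (auto simp: basis F2_prod_def zl scl)
    next
      case 3
      have "?br (?br (e i) (e 1)) (e 0) = (\<Sum>l=i+3..n. fscale (\<beta> (l - i)) (e l))"
        using 3 i by (simp only: b1 shift)
      moreover have "?br (?br (e i) (e 0)) (e 1) = (\<Sum>l=i+3..n. fscale (\<beta> (l - i)) (e l))"
      proof (cases "i + 1 \<le> n")
        case True
        then have "?br (?br (e i) (e 0)) (e 1) = ?br (e (i + 1)) (e 1)"
          using 3 i by (simp add: b0)
        also have "\<dots> = (\<Sum>l=i+1+2..n. fscale (\<beta> (l + 1 - (i + 1))) (e l))"
          using 3 True by (intro b1) auto
        finally show ?thesis by (simp add: numeral_eq_Suc)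
      next
        case False
        then show ?thesis using 3 i by (simp add: b0 zl)
      qed
      ultimately show ?thesis by simp
    qed
  qed
  have comm_e: "?br (?br (e i) (e j)) (e k) = ?br (?br (e i) (e k)) (e j)"
    if "i \<le> n" "j \<le> n" "k \<le> n" for i j k
  proof -
    consider "j \<ge> 2" | "k \<ge> 2" | "j = k" | "j = 0" "k = 1" | "j = 1" "k = 0" by linarith
    then show ?thesis
      using that by cases (simp_all add: high zl comm01 del: One_nat_def)
  qed
  have comm: "?br (?br x y) z = ?br (?br x z) y"
    if x: "x \<in> space ?A" and y: "y \<in> space ?A" and z: "z \<in> space ?A" for x y z
  proof -
    have 1: "?br (?br (e i) (e j)) z = ?br (?br (e i) z) (e j)" if "i \<le> n" "j \<le> n" for i j
      by (subst (1 2) F2_expand [OF z]) (auto simp: suml sumr scl scr comm_e that)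
    have 2: "?br (?br (e i) y) z = ?br (?br (e i) z) y" if "i \<le> n" for i
      by (subst (1 2) F2_expand [OF y]) (auto simp: suml sumr scl scr 1 that)
    show ?thesis
      by (subst (1 2) F2_expand [OF x]) (auto simp: suml sumr scl scr 2)
  qed
  show ?thesis
    by unfold_locales
      (auto simp: fs.scale_right_distrib fs.scale_left_distrib sub closed addl addr scl scr ann
        intro: comm)
qed

end

(* A derivation d is triangular in the basis e 0, ..., e n, with diagonal a, b, 2 a, 3 a, ..., n a.
   Applying d to [e 1, e 1] gives n a = 2 b, so d is nilpotent as soon as a = 0. If some coefficient
   \<beta> s with s < n is nonzero, the first one gives (s - 1) a = b through [e 0, e 1]; hence
   n = 2 (s - 1) when a is nonzero, which is impossible for odd n. Only \<beta> n and \<gamma> can then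
   survive, and replacing e 0 by e 0 - (\<beta> n / \<gamma>) e 1, with a matching change of e 1, removes \<beta> n. *)
theory Submission
  imports Defs
begin

section \<open>The bracket in coordinates, and linear maps on basis expansions\<close>

declare F2_simps(3) [simp del]

text \<open>Only right multiplication by \<open>e 0\<close> and \<open>e 1\<close> is nonzero, so
  the double sum collapses to two columns: \<open>e 0\<close> shifts coordinates, \<open>e 1\<close>
  convolves them with \<beta>. Later arguments compare single coordinates through this
  formula.\<close>

lemma F2_bracket_apply:
  assumes "n \<ge> 3"
  shows "bracket (F2 n \<beta> \<gamma>) x y k =
    (if k = 2 then y 0 * x 0
     else if 3 \<le> k \<and> k \<le> n then
       y 0 * x (k - 1) + y 1 * (x 0 * \<beta> k + (\<Sum>i=2..k-2. x i * \<beta> (k + 1 - i)) +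
         (if k = n then x 1 * \<gamma> else 0))
     else 0)"
proof -
  let ?p = "F2_prod n \<beta> \<gamma>"
  have inner: "(\<Sum>j\<le>n. x i * y j * ?p i j k) = x i * y 0 * ?p i 0 k + x i * y 1 * ?p i 1 k" for i
  proof -
    have "(\<Sum>j\<le>n. x i * y j * ?p i j k) = (\<Sum>j\<in>{0,1}. x i * y j * ?p i j k)"
      using assms by (intro sum.mono_neutral_right) (auto simp: F2_prod_def)
    then show ?thesis by simp
  qed
  have p0: "?p i 0 k = (if i = 0 \<and> k = 2 \<or> 2 \<le> i \<and> i \<le> n - 1 \<and> k = i + 1 then 1 else 0)" for i
    by (auto simp: F2_prod_def e_def)
  have coeff: "(\<Sum>l=m..n. fscale (c l) (e l)) k = (if m \<le> k \<and> k \<le> n then c k else 0)" for c m k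
    by (simp add: sum_fun_apply fscale_apply e_def if_distrib [of "\<lambda>t. _ * t"] cong: if_cong)
  have e_apply: "e l k = (if k = l then 1 else 0)" for l
    by (simp add: e_def)
  have p1: "?p i 1 k =
      (if i = 0 then (if 3 \<le> k \<and> k \<le> n then \<beta> k else 0)
       else if i = 1 then (if k = n then \<gamma> else 0)
       else if i + 2 \<le> k \<and> k \<le> n then \<beta> (k + 1 - i) else 0)" for i
    unfolding F2_prod_def using assms by (auto simp: coeff fscale_apply e_apply)
  have split: "(\<Sum>i\<le>n. f i) = f 0 + f 1 + (\<Sum>i=2..n. f i)" for f :: "nat \<Rightarrow> complex"
  proof -
    have "{..n} = {0, 1} \<union> {2..n}" using assms by auto
    then show ?thesis by (simp add: sum.union_disjoint)
  qed
  have s0: "(\<Sum>i\<le>n. x i * y 0 * ?p i 0 k) =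
      (if k = 2 then y 0 * x 0 else if 3 \<le> k \<and> k \<le> n then y 0 * x (k - 1) else 0)"
  proof -
    have "(\<Sum>i=2..n. x i * y 0 * ?p i 0 k) =
        (\<Sum>i=2..n. if i = k - 1 then (if 3 \<le> k \<and> k \<le> n then y 0 * x (k - 1) else 0) else 0)"
      using assms by (intro sum.cong) (auto simp: p0)
    also have "\<dots> = (if 3 \<le> k \<and> k \<le> n then y 0 * x (k - 1) else 0)"
      by (auto simp: sum.delta)
    finally show ?thesis by (auto simp: split p0)
  qed
  have s1: "(\<Sum>i\<le>n. x i * y 1 * ?p i 1 k) =
      (if 3 \<le> k \<and> k \<le> n then
        y 1 * (x 0 * \<beta> k + (\<Sum>i=2..k-2. x i * \<beta> (k + 1 - i)) + (if k = n then x 1 * \<gamma> else 0))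
       else 0)"
  proof -
    have "(\<Sum>i=2..n. x i * y 1 * ?p i 1 k) =
        (if 3 \<le> k \<and> k \<le> n then y 1 * (\<Sum>i=2..k-2. x i * \<beta> (k + 1 - i)) else 0)"
    proof (cases "3 \<le> k \<and> k \<le> n")
      case True
      then have "(\<Sum>i=2..n. x i * y 1 * ?p i 1 k) = (\<Sum>i=2..k-2. x i * y 1 * ?p i 1 k)"
        by (intro sum.mono_neutral_right) (auto simp: p1 simp del: One_nat_def)
      also have "\<dots> = (\<Sum>i=2..k-2. y 1 * (x i * \<beta> (k + 1 - i)))"
        using True by (intro sum.cong) (auto simp: p1 simp del: One_nat_def)
      finally show ?thesis using True by (simp add: sum_distrib_left)
    next
      case False
      then show ?thesis
        by (auto simp: p1 simp del: One_nat_def intro!: sum.neutral)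
    qed
    then show ?thesis
      using assms by (auto simp: split p1 algebra_simps simp del: One_nat_def)
  qed
  have "bracket (F2 n \<beta> \<gamma>) x y k =
      (\<Sum>i\<le>n. x i * y 0 * ?p i 0 k) + (\<Sum>i\<le>n. x i * y 1 * ?p i 1 k)"
    by (simp add: F2_simps(3) sum_fun_apply fscale_apply inner sum.distrib del: One_nat_def)
  then show ?thesis
    unfolding s0 s1 by (auto simp: algebra_simps)
qed

text \<open>Linearity is granted only on \<open>space\<close>, so the induction must also place
  every summand and partial sum there; \<open>I \<subseteq> {..n}\<close> ensures this. The empty
  sum is homogeneity with scalar 0.\<close>

lemma linear_map_sum:
  assumes d: "linear_map (F2 n \<beta> \<gamma>) (F2 n \<beta>' \<gamma>') d" and I: "I \<subseteq> {..n}"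
  shows "d (\<Sum>i\<in>I. fscale (c i) (e i)) = (\<Sum>i\<in>I. fscale (c i) (d (e i)))"
proof -
  have "finite I" using I finite_subset by blast
  then show ?thesis using I
  proof (induction I)
    case empty
    have "0 \<in> space (F2 n \<beta> \<gamma>)" by simp
    then have "d (smul (F2 n \<beta> \<gamma>) 0 0) = smul (F2 n \<beta>' \<gamma>') 0 (d 0)"
      using d unfolding linear_map_def by blast
    then show ?case by (simp del: zero_fun_apply)
  next
    case (insert i I)
    have "fscale (c i) (e i) \<in> space (F2 n \<beta> \<gamma>)"
      using insert.prems by (auto simp: fscale_apply e_def)
    moreover have "(\<Sum>i\<in>I. fscale (c i) (e i)) \<in> space (F2 n \<beta> \<gamma>)"
      using insert.prems by (auto simp: sum_fun_apply fscale_apply e_def intro!: sum.neutral)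
    moreover have "e i \<in> space (F2 n \<beta> \<gamma>)"
      using insert.prems by (auto simp: e_def)
    ultimately have "d (fscale (c i) (e i) + (\<Sum>i\<in>I. fscale (c i) (e i))) =
        fscale (c i) (d (e i)) + d (\<Sum>i\<in>I. fscale (c i) (e i))"
      using d unfolding linear_map_def F2_simps(2) by metis
    then show ?case
      using insert.IH insert.prems unfolding sum.insert [OF insert.hyps]
      by (simp only: insert_subset)
  qed
qed

section \<open>Matrix entries of a derivation\<close>

context
  fixes n :: nat and \<beta> :: "nat \<Rightarrow> complex" and \<gamma> :: complex and d
  assumes n: "n \<ge> 3" and der: "derivation (F2 n \<beta> \<gamma>) d"
begin

lemma derivation_linear_map: "linear_map (F2 n \<beta> \<gamma>) (F2 n \<beta> \<gamma>) d"
  using der by (simp add: derivation_def)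

lemma derivation_basis_product:
  assumes "i \<le> n" "j \<le> n"
  shows "d (F2_prod n \<beta> \<gamma> i j) =
    bracket (F2 n \<beta> \<gamma>) (d (e i)) (e j) + bracket (F2 n \<beta> \<gamma>) (e i) (d (e j))"
proof -
  have "e i \<in> space (F2 n \<beta> \<gamma>)" "e j \<in> space (F2 n \<beta> \<gamma>)"
    using assms by (auto simp: e_def)
  then show ?thesis
    using der F2_bracket_basis [OF assms, of \<beta> \<gamma>] unfolding derivation_def by metis
qed

text \<open>Since \<open>e 2\<close> is [e 0, e 0] and \<open>e (i + 1)\<close> is [e i, e 0], each
  further factor \<open>e 0\<close> adds \<open>d (e 0) 0\<close> to the diagonal entry and moves
  the leading coordinate up by one.\<close>

lemma derivation_basis_triangular:
  assumes "2 \<le> i" "i \<le> n"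
  shows "(\<forall>j<i. d (e i) j = 0) \<and> d (e i) i = of_nat i * d (e 0) 0"
  using assms
proof (induction i rule: dec_induct)
  case base
  have "d (e 2) = bracket (F2 n \<beta> \<gamma>) (d (e 0)) (e 0) + bracket (F2 n \<beta> \<gamma>) (e 0) (d (e 0))"
    using derivation_basis_product [of 0 0] by (simp add: F2_prod_def)
  then show ?case using n
    by (auto simp: F2_bracket_apply e_def)
next
  case (step i)
  have "F2_prod n \<beta> \<gamma> i 0 = e (Suc i)"
    using step by (auto simp: F2_prod_def)
  then have "d (e (Suc i)) = bracket (F2 n \<beta> \<gamma>) (d (e i)) (e 0) + bracket (F2 n \<beta> \<gamma>) (e i) (d (e 0))"
    using derivation_basis_product [of i 0] step by simp
  \<comment> \<open>The product [e i, e 1] starts only at \<open>e (i + 2)\<close>, so up to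
    coordinate i + 1 only the \<open>e 0\<close> part of \<open>y\<close> is visible.\<close>
  moreover have "bracket (F2 n \<beta> \<gamma>) (e i) y j = (if j = Suc i then y 0 else 0)"
    if "j \<le> Suc i" for j y
  proof -
    have 0: "(\<Sum>l=2..j-2. e i l * \<beta> (j + 1 - l)) = 0"
      using that step by (intro sum.neutral) (auto simp: e_def)
    then show ?thesis
      unfolding F2_bracket_apply [OF n] 0 using that step by (auto simp: e_def)
  qed
  moreover have "bracket (F2 n \<beta> \<gamma>) (d (e i)) (e 0) j =
      (if j = Suc i then of_nat i * d (e 0) 0 else 0)" if "j \<le> Suc i" for j
    unfolding F2_bracket_apply [OF n] using that step n by (auto simp: e_def [of 0])
  ultimately show ?case
    by (auto simp: algebra_simps)
qed

text \<open>Apply \<open>d\<close> to [e 1, e 0] = 0. The term [e 1, d (e 0)] is a multiple of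
  \<open>e n\<close>, so below coordinate n the shift of \<open>d (e 1)\<close> by
  \<open>e 0\<close> vanishes; coordinate 1 escapes because \<open>e 0\<close> annihilates
  \<open>e 1\<close>.\<close>

lemma derivation_e1:
  assumes "j \<noteq> 1" "j + 2 \<le> n"
  shows "d (e 1) j = 0"
proof -
  have "d 0 = bracket (F2 n \<beta> \<gamma>) (d (e 1)) (e 0) + bracket (F2 n \<beta> \<gamma>) (e 1) (d (e 0))"
    using derivation_basis_product [of 1 0] n by (simp add: F2_prod_def)
  moreover have "d 0 = 0"
    using linear_map_sum [OF derivation_linear_map, of "{}"] by simp
  ultimately have
    "bracket (F2 n \<beta> \<gamma>) (d (e 1)) (e 0) k + bracket (F2 n \<beta> \<gamma>) (e 1) (d (e 0)) k = 0" for k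
    by (metis plus_fun_apply zero_fun_apply)
  \<comment> \<open>This is where right multiplication by \<open>e 0\<close> sends coordinate j: it
    takes \<open>e 0\<close> to \<open>e 2\<close>, skipping \<open>e 1\<close>.\<close>
  note this [of "if j = 0 then 2 else j + 1"]
  moreover have "(\<Sum>l=2..j-Suc 0. e (Suc 0) l * c l) = 0" for c
    by (intro sum.neutral) (auto simp: e_def)
  ultimately show ?thesis
    using assms n by (auto simp: F2_bracket_apply e_def split: if_splits)
qed

lemma derivation_eigenvalue:
  assumes "\<gamma> \<noteq> 0"
  shows "of_nat n * d (e 0) 0 = 2 * d (e 1) 1"
proof -
  have "d (fscale \<gamma> (e n)) =
      bracket (F2 n \<beta> \<gamma>) (d (e 1)) (e 1) + bracket (F2 n \<beta> \<gamma>) (e 1) (d (e 1))"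
    using derivation_basis_product [of 1 1] n by (simp add: F2_prod_def)
  moreover have "d (fscale \<gamma> (e n)) = fscale \<gamma> (d (e n))"
    using linear_map_sum [OF derivation_linear_map, of "{n}" "\<lambda>_. \<gamma>"] by simp
  ultimately have "\<gamma> * d (e n) n =
      bracket (F2 n \<beta> \<gamma>) (d (e 1)) (e 1) n + bracket (F2 n \<beta> \<gamma>) (e 1) (d (e 1)) n"
    by (metis plus_fun_apply fscale_apply)
  moreover have "d (e n) n = of_nat n * d (e 0) 0"
    using derivation_basis_triangular n by simp
  \<comment> \<open>The range of the sum is covered exactly by \<open>derivation_e1\<close>, leaving
    only the \<gamma> terms in coordinate n.\<close>
  moreover have "(\<Sum>l=2..n-2. d (e 1) l * \<beta> (n + 1 - l)) = 0"
    using n by (intro sum.neutral) (auto simp: derivation_e1 simp del: One_nat_def)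
  moreover have "(\<Sum>l=2..n-2. e 1 l * \<beta> (n + 1 - l)) = 0"
    by (intro sum.neutral) (auto simp: e_def)
  moreover have "d (e 1) 0 = 0"
    using derivation_e1 [of 0] n by simp
  ultimately have "\<gamma> * (of_nat n * d (e 0) 0) = \<gamma> * (2 * d (e 1) 1)"
    using n by (simp add: F2_bracket_apply e_def algebra_simps)
  then show ?thesis using assms by simp
qed

text \<open>Compare coordinate s after applying \<open>d\<close> to [e 0, e 1]. Terms with k < s
  vanish by minimality and those with k > s by triangularity; s < n keeps \<gamma> out of this
  coordinate.\<close>

lemma derivation_leading_coefficient:
  assumes s: "3 \<le> s" "s < n" and "\<beta> s \<noteq> 0" and least: "\<And>k. 3 \<le> k \<Longrightarrow> k < s \<Longrightarrow> \<beta> k = 0"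
  shows "of_nat (s - 1) * d (e 0) 0 = d (e 1) 1"
proof -
  have "d (\<Sum>k=3..n. fscale (\<beta> k) (e k)) =
      bracket (F2 n \<beta> \<gamma>) (d (e 0)) (e 1) + bracket (F2 n \<beta> \<gamma>) (e 0) (d (e 1))"
    using derivation_basis_product [of 0 1] n by (simp add: F2_prod_def)
  moreover have "d (\<Sum>k=3..n. fscale (\<beta> k) (e k)) = (\<Sum>k=3..n. fscale (\<beta> k) (d (e k)))"
    by (rule linear_map_sum [OF derivation_linear_map]) auto
  ultimately have "(\<Sum>k=3..n. fscale (\<beta> k) (d (e k))) s =
      bracket (F2 n \<beta> \<gamma>) (d (e 0)) (e 1) s + bracket (F2 n \<beta> \<gamma>) (e 0) (d (e 1)) s"
    by (metis plus_fun_apply)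
  moreover have "(\<Sum>k=3..n. fscale (\<beta> k) (d (e k))) s =
      (\<Sum>k=3..n. if k = s then \<beta> s * (of_nat s * d (e 0) 0) else 0)"
    unfolding sum_fun_apply fscale_apply
    using derivation_basis_triangular least
    by (intro sum.cong refl) (auto simp: not_less neq_iff)
  \<comment> \<open>The index s + 1 - l runs through 3, ..., s - 1, where \<beta> is zero.\<close>
  moreover have "(\<Sum>l=2..s-2. d (e 0) l * \<beta> (s + 1 - l)) = 0"
    using s by (intro sum.neutral) (auto intro!: least)
  moreover have "(\<Sum>l=2..s-2. e 0 l * \<beta> (s + 1 - l)) = 0"
    by (intro sum.neutral) (auto simp: e_def)
  moreover have "d (e 1) 0 = 0"
    using derivation_e1 [of 0] n by simp
  ultimately have "\<beta> s * (of_nat s * d (e 0) 0) = \<beta> s * (d (e 0) 0 + d (e 1) 1)"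
    using n s by (simp add: F2_bracket_apply e_def algebra_simps)
  then have "of_nat s * d (e 0) 0 = d (e 0) 0 + d (e 1) 1"
    using \<open>\<beta> s \<noteq> 0\<close> by simp
  then show ?thesis
    using s by (simp add: of_nat_diff algebra_simps)
qed

text \<open>By \<open>derivation_eigenvalue\<close> the whole diagonal vanishes, so \<open>d\<close>
  is strictly triangular: each application clears one more coordinate, and n + 1 applications clear
  them all.\<close>

lemma derivation_nilpotent:
  assumes "\<gamma> \<noteq> 0" and "d (e 0) 0 = 0"
  shows "nilpotent_map (F2 n \<beta> \<gamma>) d"
proof -
  have e1: "d (e 1) 1 = 0"
    using derivation_eigenvalue assms by simp
  have strict: "d (e i) j = 0" if "i \<le> n" "j \<le> i" for i j
  proof -
    consider "i = 0" | "i = 1" "j = 0" | "i = 1" "j = 1" | "i \<ge> 2"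
      using \<open>j \<le> i\<close> by linarith
    then show ?thesis
      using that assms n e1 derivation_e1 [of 0] derivation_basis_triangular [of i]
      by cases (auto simp: le_less)
  qed
  have powers: "(d ^^ m) x \<in> space (F2 n \<beta> \<gamma>) \<and> (\<forall>j<m. (d ^^ m) x j = 0)"
    if x: "x \<in> space (F2 n \<beta> \<gamma>)" for m x
  proof (induction m)
    case 0
    then show ?case using x by simp
  next
    case (Suc m)
    define y where "y = (d ^^ m) x"
    have y: "y \<in> space (F2 n \<beta> \<gamma>)" "\<forall>j<m. y j = 0"
      using Suc by (simp_all add: y_def)
    have "d y = (\<Sum>i\<le>n. fscale (y i) (d (e i)))"
      by (subst F2_expand [OF y(1)]) (rule linear_map_sum [OF derivation_linear_map], simp)
    then have "d y j = (\<Sum>i\<le>n. y i * d (e i) j)" for j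
      by (simp add: sum_fun_apply fscale_apply)
    moreover have "y i * d (e i) j = 0" if "j < Suc m" "i \<le> n" for i j
      using that y(2) strict [of i j] by (cases "i < m") auto
    ultimately have "d y j = 0" if "j < Suc m" for j
      using that by (simp add: sum.neutral)
    moreover have "d y \<in> space (F2 n \<beta> \<gamma>)"
      using y(1) derivation_linear_map unfolding linear_map_def by blast
    ultimately show ?case by (simp add: y_def)
  qed
  have "(d ^^ Suc n) x = 0" if "x \<in> space (F2 n \<beta> \<gamma>)" for x
  proof
    fix j
    show "(d ^^ Suc n) x j = 0 j"
      using powers [OF that, of "Suc n"] by (cases "j < Suc n") auto
  qed
  then show ?thesis unfolding nilpotent_map_def by blast
qed

end

section \<open>The parity argument\<close>

lemma non_nilpotent_derivation_coefficients:
  assumes n: "n \<ge> 3" "odd n" and \<gamma>: "\<gamma> \<noteq> 0"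
    and der: "derivation (F2 n \<beta> \<gamma>) d" and "\<not> nilpotent_map (F2 n \<beta> \<gamma>) d"
    and k: "3 \<le> k" "k < n"
  shows "\<beta> k = 0"
proof (rule ccontr)
  assume "\<beta> k \<noteq> 0"
  define s where "s = (LEAST s. 3 \<le> s \<and> \<beta> s \<noteq> 0)"
  have s: "3 \<le> s" "\<beta> s \<noteq> 0"
    using LeastI [of "\<lambda>s. 3 \<le> s \<and> \<beta> s \<noteq> 0" k] k \<open>\<beta> k \<noteq> 0\<close> by (auto simp: s_def)
  have "s \<le> k"
    unfolding s_def using k \<open>\<beta> k \<noteq> 0\<close> by (intro Least_le) simp
  have "\<beta> l = 0" if "3 \<le> l" "l < s" for l
    using that not_less_Least [of l "\<lambda>s. 3 \<le> s \<and> \<beta> s \<noteq> 0"] by (auto simp: s_def)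
  then have "of_nat (s - 1) * d (e 0) 0 = d (e 1) 1"
    using derivation_leading_coefficient [OF n(1) der] s \<open>s \<le> k\<close> k by auto
  then have "of_nat n * d (e 0) 0 = of_nat (2 * (s - 1)) * d (e 0) 0"
    using derivation_eigenvalue [OF n(1) der \<gamma>] by simp
  moreover have "d (e 0) 0 \<noteq> 0"
    using derivation_nilpotent [OF n(1) der \<gamma>] assms(5) by blast
  \<comment> \<open>The factor \<open>d (e 0) 0\<close> cancels, and the embedding of the naturals
    into the complex numbers is injective.\<close>
  ultimately have "n = 2 * (s - 1)"
    by (simp only: mult_cancel_right of_nat_eq_iff) simp
  then show False using n(2) by simp
qed

section \<open>Change of basis to the normal form\<close>

text \<open>Adding c e 1 to \<open>e 0\<close> removes \<beta> n but makes the product of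
  \<open>e 1\<close> with the new \<open>e 0\<close> equal to c \<gamma> e n. Subtracting c \<gamma>
  e (n - 1) from \<open>e 1\<close> cancels this, since [e (n - 1), e 0] = e n.\<close>

lemma F2_isomorphic_normal_form:
  assumes n: "n \<ge> 3" and \<gamma>: "\<gamma> \<noteq> 0" and \<beta>: "\<And>k. 3 \<le> k \<Longrightarrow> k < n \<Longrightarrow> \<beta> k = 0"
  shows "isomorphic (F2 n \<beta> \<gamma>) (F2 n (\<lambda>k. 0) 1)"
proof -
  \<comment> \<open>Chosen so that [e 0 + c e 1, e 1] = (\<beta> n + c \<gamma>) e n
    vanishes.\<close>
  define c where "c = - \<beta> n / \<gamma>"
  \<comment> \<open>Dividing \<open>e 1\<close> by r turns [e 1, e 1] = \<gamma> e n into
    \<open>e n\<close>.\<close>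
  define r where "r = csqrt \<gamma>"
  have r: "r \<noteq> 0" "r * r = \<gamma>"
    using \<gamma> power2_csqrt [of \<gamma>] by (auto simp: r_def power2_eq_square)
  have c: "\<beta> n = - (c * \<gamma>)"
    using \<gamma> by (simp add: c_def)
  \<comment> \<open>\<open>f x\<close> lists the coordinates of \<open>x\<close> in the basis \<open>e 0 + c e 1\<close>, \<open>(e 1 - c \<gamma> e (n - 1)) / r\<close>,
    \<open>e 2, \<dots>, e n\<close>, whose products are those of the normal form.\<close>
  define f where "f = (\<lambda>x i. if i = 1 then r * (x 1 - c * x 0)
    else if i = n - 1 then x i + c * \<gamma> * (x 1 - c * x 0) else x i)"
  \<comment> \<open>The inverse of \<open>f\<close>: for \<open>y = f x\<close>, the quotient
    \<open>y 1 / r\<close> recovers \<open>x 1 - c * x 0\<close>.\<close>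
  define g where "g = (\<lambda>y i. if i = 1 then y 1 / r + c * y 0
    else if i = n - 1 then y i - c * \<gamma> * (y 1 / r) else y i)"
  have "linear_map (F2 n \<beta> \<gamma>) (F2 n (\<lambda>k. 0) 1) f"
    using n by (auto simp: linear_map_def f_def fun_eq_iff fscale_apply algebra_simps)
  moreover have "bij_betw f (space (F2 n \<beta> \<gamma>)) (space (F2 n (\<lambda>k. 0) 1))"
    using n r by (intro bij_betw_byWitness [where f' = g]) (auto simp: f_def g_def fun_eq_iff)
  moreover have "f (bracket (F2 n \<beta> \<gamma>) x y) = bracket (F2 n (\<lambda>k. 0) 1) (f x) (f y)" for x y
  proof
    fix k
    let ?z = "bracket (F2 n \<beta> \<gamma>) x y"
    \<comment> \<open>Products have zero coordinates 0 and 1, and every correction in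
      \<open>f\<close> involves only these.\<close>
    have "f ?z k = ?z k"
      using n by (simp add: f_def F2_bracket_apply)
    also have "\<dots> = bracket (F2 n (\<lambda>k. 0) 1) (f x) (f y) k"
    proof -
      have 0: "(\<Sum>i=2..k-2. x i * \<beta> (k + 1 - i)) = 0" if "3 \<le> k" "k \<le> n"
        using that by (intro sum.neutral) (auto intro!: \<beta>)
      consider "k = n" | "k = 2" | "3 \<le> k" "k < n" | "k < 2 \<or> k > n" by linarith
      then show ?thesis
      proof cases
        case 1
        \<comment> \<open>On the right, the correction in coordinate n - 1 cancels the
          \<open>c * y 0\<close> part of the last product; both sides become y 0 x (n - 1) +
          \<gamma> y 1 (x 1 - c x 0).\<close>
        have "y 0 * x (n - 1) + y 1 * (x 0 * \<beta> n + x 1 * \<gamma>) =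
            y 0 * (x (n - 1) + c * \<gamma> * (x 1 - c * x 0)) +
            (r * r) * ((y 1 - c * y 0) * (x 1 - c * x 0))"
          unfolding c r(2) by (simp add: algebra_simps)
        moreover have "n - 1 \<noteq> 1" using n by simp
        ultimately show ?thesis
          using 1 n 0 by (simp add: F2_bracket_apply f_def algebra_simps)
      next
        case 2
        then show ?thesis using n by (simp add: F2_bracket_apply f_def)
      next
        \<comment> \<open>Here 2 \<le> k - 1 < n - 1, so \<open>f\<close> leaves coordinate k - 1
          unchanged.\<close>
        case 3
        then show ?thesis using n 0 by (auto simp: F2_bracket_apply f_def \<beta>)
      next
        case 4
        then show ?thesis using n by (auto simp: F2_bracket_apply)
      qed
    qed
    finally show "f ?z k = bracket (F2 n (\<lambda>k. 0) 1) (f x) (f y) k" .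
  qed
  ultimately show ?thesis unfolding isomorphic_def by blast
qed

theorem theorem3p9:
  fixes n :: nat and \<beta> :: "nat \<Rightarrow> complex" and \<gamma> :: complex
  assumes "n \<ge> 3" and "odd n" and "\<gamma> \<noteq> 0"
    and "non_characteristically_nilpotent (F2 n \<beta> \<gamma>)"
  shows "isomorphic (F2 n \<beta> \<gamma>) (F2 n (\<lambda>k. 0) 1)"
proof -
  obtain d where "derivation (F2 n \<beta> \<gamma>) d" "\<not> nilpotent_map (F2 n \<beta> \<gamma>) d"
    using assms(4) unfolding non_characteristically_nilpotent_def by blast
  then have "\<beta> k = 0" if "3 \<le> k" "k < n" for k
    using non_nilpotent_derivation_coefficients assms(1-3) that by blast
  then show ?thesis
    using F2_isomorphic_normal_form assms(1,3) by blast
qed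

end
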